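(* Let $L$ be the "library" space defined in the context. Then $L$ is regular but not completely regular; moreover, for every point $z\in L$ the set $\{z\}$ is a zero-set of $L$, and every closed subset of $L$ is a $G_\delta$-set in $L$.
   Context: Here $\mathbb{N}=\{0,1,2,\dots\}$. The Niemytzki plane $N$: the underlying set is $N=\{\langle x,y\rangle\in\mathbb{R}^2: y\ge 0\}$. With $\|\cdot\|$ the Euclidean norm, the topology is given by the following local bases of (not necessarily open) neighbourhoods. If $y>0$, the neighbourhoods of $\langle x,y\rangle$ are $U(x,y,n)=\{\langle u,v\rangle\in N:\|\langle u,v\rangle-\langle x,y\rangle\|<2^{-n}\}$, $n\in\mathbb{N}$. If $y=0$, the neighbourhoods of $\langle x,0\rangle$ are $U(x,n)=U'(x,n)\cup\{\langle x,0\rangle\}$, $n\in\mathbb{N}$, where $U'(x,n)=\{\langle u,v\rangle:\|\langle u,v\rangle-\langle x,2^{-n}\rangle\|<2^{-n}\}$. A set is open if it contains a basic neighbourhood of each of its points. The space $L$: start with the product $N\times\mathbb{N}\times\mathbb{N}$ (each factor $\mathbb{N}$ discrete) and add one point $\infty$ to get $(N\times\mathbb{N}\times\mathbb{N})\cup\{\infty\}$, in which $N\times\mathbb{N}\times\mathbb{N}$ is an open subspace with its product topology and the basic neighbourhoods of $\infty$ are the sets $V_k=\{\infty\}\cup\bigcup_{m\ge k}\bigcup_{n\ge k}N\times\{\langle m,n\rangle\}$, $k\in\mathbb{N}$. Then $L$ is the quotient space of $(N\times\mathbb{N}\times\mathbb{N})\cup\{\infty\}$, with the quotient topology, obtained by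 making the following identifications for every $m\in\mathbb{N}$: for every even $n\in\mathbb{N}$ and every rational $q$, the point $(\langle q,0\rangle,m,n)$ is identified with $(\langle q,0\rangle,m,n+1)$; for every odd $n\in\mathbb{N}$ and every irrational $p$, the point $(\langle p,0\rangle,m,n)$ is identified with $(\langle p,0\rangle,m,n+1)$. No other identifications are made. A zero-set of a space $X$ is a set of the form $\{z\in X: f(z)=0\}$ with $f:X\to\mathbb{R}$ continuous. A $G_\delta$-set is a countable intersection of open sets. Regular and completely regular include the $T_1$ axiom. *)

theory Defs
  imports "HOL-Analysis.Analysis"
begin

section \<open>The Niemytzki plane\<close>

definition niemytzki_plane :: "(real \<times> real) set" where
  "niemytzki_plane = {(x, y). y \<ge> 0}"

text \<open>The metric on \<^typ>\<open>real \<times> real\<close> is the Euclidean one.  The basic neighbourhood of a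
  point above the axis may contain points of the axis and is then not open in the topology
  below.  The tangent disc at a point of the axis lies above the axis without being cut down.\<close>

definition niemytzki_nbhd :: "real \<times> real \<Rightarrow> nat \<Rightarrow> (real \<times> real) set" where
  "niemytzki_nbhd p n =
     (if snd p > 0 then ball p ((1/2) ^ n) \<inter> niemytzki_plane
      else insert p (ball (fst p, (1/2) ^ n) ((1/2) ^ n)))"

definition niemytzki_topology :: "(real \<times> real) topology" where
  "niemytzki_topology =
     topology (\<lambda>U. U \<subseteq> niemytzki_plane \<and> (\<forall>p\<in>U. \<exists>n. niemytzki_nbhd p n \<subseteq> U))"

lemma ball_tangent_mono:
  fixes x r s :: real
  assumes "r \<le> s"
  shows "ball (x, r) r \<subseteq> ball (x, s) s"
proof
  fix p assume p: "p \<in> ball (x, r) r"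
  have "dist (x, s) p \<le> dist (x, s) (x, r) + dist (x, r) p"
    by (rule dist_triangle)
  also have "dist (x, s) (x, r) = s - r"
    using assms by (simp add: dist_Pair_Pair dist_real_def)
  finally show "p \<in> ball (x, s) s"
    using p by auto
qed

lemma niemytzki_nbhd_antimono:
  assumes "m \<le> n"
  shows "niemytzki_nbhd p n \<subseteq> niemytzki_nbhd p m"
proof -
  have le: "(1/2::real) ^ n \<le> (1/2) ^ m"
    using assms by (simp add: power_decreasing)
  show ?thesis
    using ball_tangent_mono[OF le, of "fst p"] subset_ball[OF le, of p]
    unfolding niemytzki_nbhd_def by auto
qed

lemma niemytzki_nbhd_subset:
  assumes "p \<in> niemytzki_plane"
  shows "niemytzki_nbhd p n \<subseteq> niemytzki_plane"
proof -
  have "ball (x, r) r \<subseteq> niemytzki_plane" for x r :: real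
  proof
    fix q assume "q \<in> ball (x, r) r"
    then have "\<bar>r - snd q\<bar> < r"
      using dist_snd_le[of "(x, r)" q] by (simp add: dist_real_def)
    then show "q \<in> niemytzki_plane"
      by (cases q) (auto simp: niemytzki_plane_def)
  qed
  then show ?thesis
    using assms by (auto simp: niemytzki_nbhd_def)
qed

lemma openin_niemytzki:
  "openin niemytzki_topology U \<longleftrightarrow>
     U \<subseteq> niemytzki_plane \<and> (\<forall>p\<in>U. \<exists>n. niemytzki_nbhd p n \<subseteq> U)"
proof -
  have "istopology (\<lambda>U. U \<subseteq> niemytzki_plane \<and> (\<forall>p\<in>U. \<exists>n. niemytzki_nbhd p n \<subseteq> U))"
    unfolding istopology_def
  proof (intro conjI allI impI ballI)
    fix S T p
    assume S: "S \<subseteq> niemytzki_plane \<and> (\<forall>p\<in>S. \<exists>n. niemytzki_nbhd p n \<subseteq> S)"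
      and T: "T \<subseteq> niemytzki_plane \<and> (\<forall>p\<in>T. \<exists>n. niemytzki_nbhd p n \<subseteq> T)"
      and "p \<in> S \<inter> T"
    then obtain m n where "niemytzki_nbhd p m \<subseteq> S" "niemytzki_nbhd p n \<subseteq> T"
      by blast
    moreover have "niemytzki_nbhd p (max m n) \<subseteq> niemytzki_nbhd p m"
        "niemytzki_nbhd p (max m n) \<subseteq> niemytzki_nbhd p n"
      by (simp_all add: niemytzki_nbhd_antimono)
    ultimately show "\<exists>n. niemytzki_nbhd p n \<subseteq> S \<inter> T"
      by blast
  qed (fast | blast)+
  then show ?thesis
    by (simp add: niemytzki_topology_def)
qed

lemma topspace_niemytzki [simp]: "topspace niemytzki_topology = niemytzki_plane"
proof
  show "topspace niemytzki_topology \<subseteq> niemytzki_plane"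
    using openin_niemytzki openin_topspace by blast
  have "openin niemytzki_topology niemytzki_plane"
    using niemytzki_nbhd_subset by (auto simp: openin_niemytzki)
  then show "niemytzki_plane \<subseteq> topspace niemytzki_topology"
    by (rule openin_subset)
qed


section \<open>The space before identification\<close>

text \<open>\<^term>\<open>None\<close> is the added point at infinity; \<^term>\<open>Some (p, m, n)\<close> is the point
  \<^term>\<open>p\<close> in the copy of the Niemytzki plane with index \<^term>\<open>(m, n)\<close>.\<close>

type_synonym shelf_point = "((real \<times> real) \<times> nat \<times> nat) option"

definition shelves_topology :: "((real \<times> real) \<times> nat \<times> nat) topology" where
  "shelves_topology =
     prod_topology niemytzki_topology
       (prod_topology (discrete_topology UNIV) (discrete_topology UNIV))"

definition infinity_nbhd :: "nat \<Rightarrow> shelf_point set" where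
  "infinity_nbhd k = insert None (Some ` (niemytzki_plane \<times> {k..} \<times> {k..}))"

definition pre_library :: "shelf_point topology" where
  "pre_library =
     topology (\<lambda>W. openin shelves_topology (Some -` W) \<and>
                   (None \<in> W \<longrightarrow> (\<exists>k. infinity_nbhd k \<subseteq> W)))"

lemma topspace_shelves [simp]: "topspace shelves_topology = niemytzki_plane \<times> UNIV"
  by (simp add: shelves_topology_def)

lemma openin_pre_library:
  "openin pre_library W \<longleftrightarrow>
     openin shelves_topology (Some -` W) \<and> (None \<in> W \<longrightarrow> (\<exists>k. infinity_nbhd k \<subseteq> W))"
proof -
  have "istopology (\<lambda>W. openin shelves_topology (Some -` W) \<and>
                        (None \<in> W \<longrightarrow> (\<exists>k. infinity_nbhd k \<subseteq> W)))"
    unfolding istopology_def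
  proof (intro conjI allI impI)
    fix S T
    assume S: "openin shelves_topology (Some -` S) \<and> (None \<in> S \<longrightarrow> (\<exists>k. infinity_nbhd k \<subseteq> S))"
      and T: "openin shelves_topology (Some -` T) \<and> (None \<in> T \<longrightarrow> (\<exists>k. infinity_nbhd k \<subseteq> T))"
    show "openin shelves_topology (Some -` (S \<inter> T))"
      using S T by (auto simp: vimage_Int)
    assume "None \<in> S \<inter> T"
    then obtain k l where "infinity_nbhd k \<subseteq> S" "infinity_nbhd l \<subseteq> T"
      using S T by blast
    moreover have "infinity_nbhd (max k l) \<subseteq> infinity_nbhd k"
        "infinity_nbhd (max k l) \<subseteq> infinity_nbhd l"
      by (auto simp: infinity_nbhd_def)
    ultimately show "\<exists>k. infinity_nbhd k \<subseteq> S \<inter> T"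
      by blast
  next
    fix K
    assume K: "\<forall>W\<in>K. openin shelves_topology (Some -` W) \<and>
                     (None \<in> W \<longrightarrow> (\<exists>k. infinity_nbhd k \<subseteq> W))"
    then show "openin shelves_topology (Some -` \<Union>K)"
      by (auto simp: vimage_Union)
    assume "None \<in> \<Union>K"
    with K show "\<exists>k. infinity_nbhd k \<subseteq> \<Union>K"
      by (meson UnionE Union_upper subset_trans)
  qed
  then show ?thesis
    by (simp add: pre_library_def)
qed

lemma topspace_pre_library: "topspace pre_library = insert None (Some ` (niemytzki_plane \<times> UNIV))"
proof
  have "Some -` topspace pre_library \<subseteq> niemytzki_plane \<times> UNIV"
    using openin_pre_library[of "topspace pre_library"] openin_subset[of shelves_topology]
    by fastforce
  then show "topspace pre_library \<subseteq> insert None (Some ` (niemytzki_plane \<times> UNIV))"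
    by (smt (verit) image_eqI insertCI not_None_eq subset_iff vimageI)
  let ?W = "insert None (Some ` (niemytzki_plane \<times> (UNIV :: (nat \<times> nat) set)))"
  have "Some -` ?W = topspace shelves_topology"
    by auto
  moreover have "infinity_nbhd 0 \<subseteq> ?W"
    by (auto simp: infinity_nbhd_def)
  ultimately have "openin pre_library ?W"
    unfolding openin_pre_library by (metis openin_topspace)
  then show "?W \<subseteq> topspace pre_library"
    by (rule openin_subset)
qed


section \<open>The quotient\<close>

definition glue :: "shelf_point \<Rightarrow> shelf_point \<Rightarrow> bool" where
  "glue a b \<longleftrightarrow>
     (\<exists>x m n. a = Some ((x, 0), m, n) \<and> b = Some ((x, 0), m, n + 1) \<and>
              (even n \<and> x \<in> \<rat> \<or> odd n \<and> x \<notin> \<rat>))"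

definition glue_rel :: "(shelf_point \<times> shelf_point) set" where
  "glue_rel = {(a, b). equivclp glue a b}"

definition library_space :: "shelf_point set topology" where
  "library_space =
     topology (\<lambda>U. U \<subseteq> topspace pre_library // glue_rel \<and> openin pre_library (\<Union>U))"

lemma equiv_glue_rel: "equiv UNIV glue_rel"
  unfolding glue_rel_def
  by (auto intro!: equivI refl_onI symI transI intro: equivclp_sym equivclp_trans)

lemma glue_rel_topspace:
  assumes "(a, b) \<in> glue_rel" "a \<in> topspace pre_library"
  shows "b \<in> topspace pre_library"
proof -
  have "equivclp glue a b"
    using assms(1) by (simp add: glue_rel_def)
  then show ?thesis
    using assms(2)
    by (induction rule: equivclp_induct)
       (auto simp: glue_def topspace_pre_library niemytzki_plane_def)
qed

lemma openin_library_space: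
  "openin library_space U \<longleftrightarrow>
     U \<subseteq> topspace pre_library // glue_rel \<and> openin pre_library (\<Union>U)"
proof -
  have "istopology (\<lambda>U. U \<subseteq> topspace pre_library // glue_rel \<and> openin pre_library (\<Union>U))"
    unfolding istopology_def
  proof (intro conjI allI impI)
    fix S T
    assume S: "S \<subseteq> topspace pre_library // glue_rel \<and> openin pre_library (\<Union>S)"
      and T: "T \<subseteq> topspace pre_library // glue_rel \<and> openin pre_library (\<Union>T)"
    then show "S \<inter> T \<subseteq> topspace pre_library // glue_rel"
      by blast
    have "topspace pre_library // glue_rel \<subseteq> UNIV // glue_rel"
      by (auto simp: quotient_def)
    then have "\<Union>S \<inter> \<Union>T = \<Union>(S \<inter> T)"
      using S T quotient_disj[OF equiv_glue_rel] by blast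
    then show "openin pre_library (\<Union>(S \<inter> T))"
      using S T by (metis openin_Int)
  next
    fix K
    assume K: "\<forall>U\<in>K. U \<subseteq> topspace pre_library // glue_rel \<and> openin pre_library (\<Union>U)"
    then show "\<Union>K \<subseteq> topspace pre_library // glue_rel"
      by blast
    have "\<Union>(\<Union>K) = \<Union>(Union ` K)"
      by blast
    then show "openin pre_library (\<Union>(\<Union>K))"
      using K by (metis (no_types, lifting) imageE openin_Union)
  qed
  then show ?thesis
    by (simp add: library_space_def)
qed

lemma topspace_library_space: "topspace library_space = topspace pre_library // glue_rel"
proof
  show "topspace library_space \<subseteq> topspace pre_library // glue_rel"
    using openin_library_space openin_topspace by blast
  have "\<Union>(topspace pre_library // glue_rel) = topspace pre_library"
    using glue_rel_topspace equiv_class_self[OF equiv_glue_rel]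
    by (fastforce simp: quotient_def)
  then have "openin library_space (topspace pre_library // glue_rel)"
    by (simp add: openin_library_space)
  then show "topspace pre_library // glue_rel \<subseteq> topspace library_space"
    by (rule openin_subset)
qed

lemma quotient_map_library_space:
  "quotient_map pre_library library_space (\<lambda>a. glue_rel `` {a})"
  unfolding quotient_map_def
proof (intro conjI allI impI)
  show "(\<lambda>a. glue_rel `` {a}) ` topspace pre_library = topspace library_space"
    by (auto simp: topspace_library_space quotient_def)
  fix U assume U: "U \<subseteq> topspace library_space"
  have "{a \<in> topspace pre_library. glue_rel `` {a} \<in> U} = \<Union>U"
  proof
    show "{a \<in> topspace pre_library. glue_rel `` {a} \<in> U} \<subseteq> \<Union>U"
      using equiv_class_self[OF equiv_glue_rel] by blast
    show "\<Union>U \<subseteq> {a \<in> topspace pre_library. glue_rel `` {a} \<in> U}"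
    proof
      fix a assume "a \<in> \<Union>U"
      then obtain b where b: "b \<in> topspace pre_library" "glue_rel `` {b} \<in> U" "(b, a) \<in> glue_rel"
        using U by (auto simp: topspace_library_space quotient_def)
      then show "a \<in> {a \<in> topspace pre_library. glue_rel `` {a} \<in> U}"
        using glue_rel_topspace equiv_class_eq[OF equiv_glue_rel] by fastforce
    qed
  qed
  then show "openin pre_library {a \<in> topspace pre_library. glue_rel `` {a} \<in> U} \<longleftrightarrow>
      openin library_space U"
    using U by (simp add: openin_library_space topspace_library_space)
qed


section \<open>Zero-sets\<close>

definition zero_set_in :: "'a topology \<Rightarrow> 'a set \<Rightarrow> bool" where
  "zero_set_in X S \<longleftrightarrow>
     (\<exists>f. continuous_map X euclideanreal f \<and> S = {z \<in> topspace X. f z = 0})"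

end

theory Submission
  imports Defs
begin

text \<open>Call the copy of the Niemytzki plane with index \<open>(m, n)\<close> the shelf \<open>n\<close> of the row \<open>m\<close>.  Within
  a row, two successive shelves are glued along a seam on the axis, which is alternately the
  rationals and the irrationals.  So the two seams on a shelf are disjoint, and a point of the
  library lies on at most two shelves.

  The space is not completely regular, because a continuous function cannot forget along a row.
  By the Baire category theorem, a continuous function on the Niemytzki plane has arbitrarily small
  oscillation on suitable subintervals of every interval of the axis
  (\<open>niemytzki_axis_small_oscillation\<close>).  As each seam is dense, a function that is 1 on the
  irrational seamless points of shelf 0 is close to 1 on part of every interval of shelf 0, then of
  shelf 1, and so on (\<open>library_row_nearly_constant\<close>).  Hence it cannot vanish at infinity, although
  infinity is outside the closed set of these points.

  Infinity is the only bad point.  At a point on the shelves the Niemytzki plane has a continuous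
  function that vanishes there only and is 1 off a given neighbourhood and on the rest of the axis
  (\<open>niemytzki_separating_function\<close>).  Its copies on the shelves of the point, continued by 1, show
  that the point is a zero-set and has small closed neighbourhoods
  (\<open>library_separating_function_shelf\<close>).  At infinity, regularity needs only that a neighbourhood
  can be made closed by giving up one shelf (\<open>library_closed_nbhd_infinity\<close>), and the reciprocal of
  the row number shows that infinity is a zero-set.

  Finally, a closed set is a \<open>G\<^sub>\<delta>\<close> on each shelf by means of open sets that have the same trace
  on the axis as the closed set itself (\<open>Inter_niemytzki_collar\<close>), so that these open sets can be
  glued.\<close>

section \<open>The Niemytzki plane\<close>

lemma niemytzki_nbhd_axis:
  "niemytzki_nbhd (x, 0) n = insert (x, 0) (ball (x, (1/2) ^ n) ((1/2) ^ n))"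
  by (simp add: niemytzki_nbhd_def)

lemma tangent_disc_above_axis:
  fixes x r :: real
  assumes "q \<in> ball (x, r) r"
  shows "snd q > 0"
  using assms dist_snd_le[of "(x, r)" q] by (auto simp: dist_real_def)

lemma niemytzki_nbhd_subset_ball:
  assumes "p \<in> niemytzki_plane"
  shows "niemytzki_nbhd p n \<subseteq> ball p (2 * (1/2) ^ n)"
proof (cases "snd p > 0")
  case True
  moreover have "ball p ((1/2) ^ n) \<subseteq> ball p (2 * (1/2) ^ n)"
    by (intro subset_ball) simp
  ultimately show ?thesis
    by (auto simp: niemytzki_nbhd_def)
next
  case False
  then obtain x where p: "p = (x, 0)"
    using assms by (cases p) (auto simp: niemytzki_plane_def)
  have "dist p q < 2 * (1/2) ^ n" if q: "dist (x, (1/2) ^ n) q < (1/2::real) ^ n" for q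
  proof -
    have "dist p q \<le> dist p (x, (1/2) ^ n) + dist (x, (1/2) ^ n) q"
      by (rule dist_triangle)
    moreover have "dist p (x, (1/2) ^ n) = (1/2) ^ n"
      by (simp add: p dist_Pair_Pair dist_real_def)
    ultimately show ?thesis
      using q by linarith
  qed
  then show ?thesis
    by (auto simp: p niemytzki_nbhd_axis)
qed

lemma niemytzki_nbhd_small:
  assumes "p \<in> niemytzki_plane" "e > 0"
  shows "\<exists>n. niemytzki_nbhd p n \<subseteq> ball p e"
proof -
  obtain n where "(1/2::real) ^ n < e / 2"
    using assms real_arch_pow_inv[of "e/2" "1/2"] by auto
  then have "ball p (2 * (1/2) ^ n) \<subseteq> ball p e"
    by (intro subset_ball) simp
  then show ?thesis
    using niemytzki_nbhd_subset_ball[OF assms(1)] by blast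
qed

lemma continuous_map_niemytzki:
  fixes h :: "real \<times> real \<Rightarrow> real"
  shows "continuous_map niemytzki_topology euclideanreal h \<longleftrightarrow>
     (\<forall>p\<in>niemytzki_plane. \<forall>e>0. \<exists>n. \<forall>q\<in>niemytzki_nbhd p n. dist (h p) (h q) < e)"
    (is "?L \<longleftrightarrow> ?R")
proof
  assume L: ?L
  show ?R
  proof (intro ballI allI impI)
    fix p and e :: real assume p: "p \<in> niemytzki_plane" "e > 0"
    then have "openin niemytzki_topology {q \<in> topspace niemytzki_topology. h q \<in> ball (h p) e}"
      by (intro openin_continuous_map_preimage[OF L]) simp
    then show "\<exists>n. \<forall>q\<in>niemytzki_nbhd p n. dist (h p) (h q) < e"
      using p unfolding openin_niemytzki by fastforce
  qed
next
  assume R: ?R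
  have "openin niemytzki_topology {p \<in> niemytzki_plane. h p \<in> U}" if U: "open U" for U
    unfolding openin_niemytzki
  proof (intro conjI ballI)
    fix p assume p: "p \<in> {p \<in> niemytzki_plane. h p \<in> U}"
    then obtain e where e: "e > 0" "ball (h p) e \<subseteq> U"
      using U openE by blast
    then obtain n where "\<forall>q\<in>niemytzki_nbhd p n. dist (h p) (h q) < e"
      using R p by blast
    then show "\<exists>n. niemytzki_nbhd p n \<subseteq> {p \<in> niemytzki_plane. h p \<in> U}"
      using e p niemytzki_nbhd_subset[of p n] by (intro exI[of _ n]) auto
  qed simp
  then show ?L
    by (simp add: continuous_map_def)
qed

lemma isCont_imp_niemytzki_nbhd:
  fixes h :: "real \<times> real \<Rightarrow> real"
  assumes "isCont h p" "p \<in> niemytzki_plane" "e > 0"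
  shows "\<exists>n. \<forall>q\<in>niemytzki_nbhd p n. dist (h p) (h q) < e"
proof -
  obtain d where "d > 0" "\<forall>q. dist q p < d \<longrightarrow> dist (h q) (h p) < e"
    using assms(1,3) unfolding continuous_at_eps_delta by blast
  then show ?thesis
    using niemytzki_nbhd_small[of p d] assms(2) by (fastforce simp: dist_commute)
qed

lemma continuous_map_niemytzki_imp_isCont:
  fixes f :: "real \<times> real \<Rightarrow> real"
  assumes f: "continuous_map niemytzki_topology euclideanreal f" and p: "snd p > 0"
  shows "isCont f p"
  unfolding continuous_at_eps_delta
proof (intro allI impI)
  fix e :: real assume "e > 0"
  moreover have "p \<in> niemytzki_plane"
    using p by (cases p) (simp add: niemytzki_plane_def)
  ultimately obtain n where n: "\<forall>q\<in>niemytzki_nbhd p n. dist (f p) (f q) < e"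
    using f unfolding continuous_map_niemytzki by blast
  have "q \<in> niemytzki_nbhd p n" if "dist q p < min ((1/2) ^ n) (snd p)" for q
  proof -
    have "snd q \<ge> 0"
      using that dist_snd_le[of q p] unfolding dist_real_def by linarith
    then show ?thesis
      using that p by (cases q) (auto simp: niemytzki_nbhd_def niemytzki_plane_def dist_commute)
  qed
  then show "\<exists>d>0. \<forall>q. dist q p < d \<longrightarrow> dist (f q) (f p) < e"
    using n p by (intro exI[of _ "min ((1/2) ^ n) (snd p)"]) (auto simp: dist_commute)
qed

lemma niemytzki_plane_cases:
  assumes "p \<in> niemytzki_plane"
  obtains (above) "snd p > 0" | (axis) x where "p = (x, 0)"
  using assms by (cases p) (force simp: niemytzki_plane_def)

lemma mem_tangent_disc_iff:
  fixes x r u v :: real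
  assumes "r > 0"
  shows "(u, v) \<in> ball (x, r) r \<longleftrightarrow> (u - x)\<^sup>2 + v\<^sup>2 < 2 * r * v"
proof -
  have "(u, v) \<in> ball (x, r) r \<longleftrightarrow> sqrt ((x - u)\<^sup>2 + (r - v)\<^sup>2) < sqrt (r\<^sup>2)"
    using assms by (simp add: dist_Pair_Pair dist_real_def)
  also have "\<dots> \<longleftrightarrow> (x - u)\<^sup>2 + (r - v)\<^sup>2 < r\<^sup>2"
    by (rule real_sqrt_less_iff)
  also have "\<dots> \<longleftrightarrow> (u - x)\<^sup>2 + v\<^sup>2 < 2 * r * v"
    by (simp add: power2_eq_square algebra_simps)
  finally show ?thesis .
qed

text \<open>Write \<open>N\<close> for the squared distance to \<^term>\<open>(x, 0)\<close>.  The tangent disc of radius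
  \<^term>\<open>s\<close> at this point is given by \<open>N < 2 * s * v\<close>.  With \<open>r = (1/2) ^ n\<close>, the function
  \<open>h = N / max N (2 * r * v)\<close> therefore has the tangent discs of radius \<open>e * r\<close> as its sublevel
  sets \<open>h < e\<close>, for \<open>e \<le> 1\<close>, up to the point of tangency.  This gives continuity at that point;
  elsewhere the denominator does not vanish and \<open>h\<close> is continuous for the Euclidean topology.\<close>

lemma niemytzki_separating_function_axis:
  fixes x :: real
  shows "\<exists>h. continuous_map niemytzki_topology euclideanreal h \<and>
           (\<forall>q\<in>niemytzki_plane. h q = 0 \<longleftrightarrow> q = (x, 0)) \<and>
           (\<forall>q\<in>niemytzki_plane - niemytzki_nbhd (x, 0) n. h q = 1)"
proof -
  define r where "r = (1/2::real) ^ n"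
  have r: "r > 0"
    by (simp add: r_def)
  define N where "N = (\<lambda>q::real \<times> real. (fst q - x)\<^sup>2 + (snd q)\<^sup>2)"
  define h where "h = (\<lambda>q. N q / max (N q) (2 * r * snd q))"
  have N_pos: "N q > 0" if "q \<noteq> (x, 0)" for q
    using that by (cases q) (auto simp: N_def sum_power2_gt_zero_iff)
  have N_0: "N (x, 0) = 0"
    by (simp add: N_def)
  have cont: "isCont h q" if "q \<noteq> (x, 0)" for q
  proof -
    have "max (N q) (2 * r * snd q) \<noteq> 0"
      using N_pos[OF that] by linarith
    then show ?thesis
      unfolding h_def N_def by (intro continuous_intros)
  qed
  have h_le: "h q < e" if q: "q \<in> niemytzki_nbhd (x, 0) k" and k: "(1/2) ^ k < e * r" "e > 0" for q k e
  proof (cases "q = (x, 0)")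
    case True
    then show ?thesis
      using that by (simp add: h_def N_0)
  next
    case False
    obtain u v where uv: "q = (u, v)"
      by fastforce
    have disc: "q \<in> ball (x, (1/2) ^ k) ((1/2) ^ k)"
      using q False by (auto simp: niemytzki_nbhd_axis)
    have v: "v > 0"
      using tangent_disc_above_axis[OF disc] uv by simp
    have "N q < 2 * (1/2) ^ k * v"
      using disc by (simp add: uv N_def mem_tangent_disc_iff del: mem_ball)
    also have "\<dots> < 2 * (e * r) * v"
      using k v by simp
    finally have "N q < e * (2 * r * v)"
      by (simp add: algebra_simps)
    also have "\<dots> \<le> e * max (N q) (2 * r * v)"
      using k by simp
    finally show ?thesis
      using N_pos[OF False] by (simp add: h_def uv pos_divide_less_eq less_max_iff_disj)
  qed
  have h_nonneg: "h q \<ge> 0" if "q \<in> niemytzki_plane" for q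
    using that r by (cases q) (auto simp: h_def N_def niemytzki_plane_def le_max_iff_disj)
  have "continuous_map niemytzki_topology euclideanreal h"
    unfolding continuous_map_niemytzki
  proof (intro ballI allI impI)
    fix p and e :: real assume p: "p \<in> niemytzki_plane" and e: "e > 0"
    show "\<exists>n. \<forall>q\<in>niemytzki_nbhd p n. dist (h p) (h q) < e"
    proof (cases "p = (x, 0)")
      case True
      obtain k where k: "(1/2) ^ k < e * r"
        using real_arch_pow_inv[of "e * r" "1/2"] e r by auto
      have "dist (h p) (h q) < e" if "q \<in> niemytzki_nbhd p k" for q
      proof -
        have "h q \<ge> 0"
          using that p h_nonneg niemytzki_nbhd_subset by blast
        then show ?thesis
          using h_le[of q k e] that k e True by (simp add: h_def N_0 dist_real_def)
      qed
      then show ?thesis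
        by blast
    next
      case False
      then show ?thesis
        using isCont_imp_niemytzki_nbhd[OF cont p e] by blast
    qed
  qed
  moreover have "h q = 0 \<longleftrightarrow> q = (x, 0)" for q
    using N_pos[of q] by (cases "q = (x, 0)") (auto simp: h_def N_0 max_def)
  moreover have "h q = 1" if "q \<in> niemytzki_plane - niemytzki_nbhd (x, 0) n" for q
  proof -
    obtain u v where uv: "q = (u, v)"
      by fastforce
    have "q \<noteq> (x, 0)" "q \<notin> ball (x, r) r"
      using that by (auto simp: niemytzki_nbhd_axis r_def)
    then show ?thesis
      using r N_pos[of q] by (auto simp: uv h_def mem_tangent_disc_iff N_def max_def simp del: mem_ball)
  qed
  ultimately show ?thesis
    by blast
qed

text \<open>The last clause makes the function usable in the library: gluing takes place along the axis
  only, so a function that is 1 on the axis outside \<^term>\<open>p\<close> can be continued by 1 to the other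
  copies of the plane.  Above the axis a truncated distance will do, if it reaches 1 before the
  axis.\<close>

lemma niemytzki_separating_function:
  assumes V: "openin niemytzki_topology V" "p \<in> V"
  shows "\<exists>h. continuous_map niemytzki_topology euclideanreal h \<and>
           (\<forall>q\<in>niemytzki_plane. h q = 0 \<longleftrightarrow> q = p) \<and>
           (\<forall>q\<in>niemytzki_plane - V. h q = 1) \<and>
           (\<forall>x. (x, 0) \<noteq> p \<longrightarrow> h (x, 0) = 1)"
proof -
  obtain n where n: "niemytzki_nbhd p n \<subseteq> V" and p: "p \<in> niemytzki_plane"
    using V openin_niemytzki by blast
  from p show ?thesis
  proof (cases rule: niemytzki_plane_cases)
    case above
    define r where "r = min ((1/2) ^ n) (snd p)"
    have r: "r > 0"
      using above by (simp add: r_def)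
    define h where "h = (\<lambda>q. min 1 (dist p q / r))"
    have "isCont h q" for q
      unfolding h_def by (intro continuous_intros) (use r in auto)
    then have "continuous_map niemytzki_topology euclideanreal h"
      using isCont_imp_niemytzki_nbhd unfolding continuous_map_niemytzki by blast
    moreover have "h q = 0 \<longleftrightarrow> q = p" for q
      using r by (auto simp: h_def min_def)
    moreover have "h q = 1" if "q \<in> niemytzki_plane - V" for q
    proof -
      have "q \<notin> ball p ((1/2) ^ n)"
        using that n above by (auto simp: niemytzki_nbhd_def)
      then have "r \<le> dist p q"
        by (simp add: r_def)
      then show ?thesis
        using r by (simp add: h_def)
    qed
    moreover have "h (x, 0) = 1" for x
    proof -
      have "r \<le> dist p (x, 0)"
        using dist_snd_le[of p "(x, 0)"] above by (simp add: r_def dist_real_def)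
      then show ?thesis
        using r by (simp add: h_def)
    qed
    ultimately show ?thesis
      by blast
  next
    case (axis x)
    obtain h where h: "continuous_map niemytzki_topology euclideanreal h"
        "\<forall>q\<in>niemytzki_plane. h q = 0 \<longleftrightarrow> q = p"
        "\<forall>q\<in>niemytzki_plane - niemytzki_nbhd p n. h q = 1"
      using niemytzki_separating_function_axis axis by blast
    moreover have "(y, 0) \<in> niemytzki_plane - niemytzki_nbhd p n" if "(y, 0) \<noteq> p" for y
      using that tangent_disc_above_axis[of "(y, 0)" x]
      by (auto simp: axis niemytzki_nbhd_axis niemytzki_plane_def)
    ultimately show ?thesis
      using n by blast
  qed
qed

text \<open>Every subset of the axis is closed, since a neighbourhood of an axis point contains no other
  point of the axis.\<close>

lemma openin_niemytzki_remove_axis_points: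
  "openin niemytzki_topology (niemytzki_plane - {(x, 0) | x. x \<in> A})"
  unfolding openin_niemytzki
proof (intro conjI ballI)
  fix p assume p: "p \<in> niemytzki_plane - {(x, 0) | x. x \<in> A}"
  then have "p \<in> niemytzki_plane"
    by blast
  then show "\<exists>n. niemytzki_nbhd p n \<subseteq> niemytzki_plane - {(x, 0) | x. x \<in> A}"
  proof (cases rule: niemytzki_plane_cases)
    case above
    obtain n where "niemytzki_nbhd p n \<subseteq> ball p (snd p)"
      using niemytzki_nbhd_small p above by blast
    moreover have "(x, 0) \<notin> ball p (snd p)" for x
      using dist_snd_le[of p "(x, 0)"] above by (simp add: dist_real_def)
    ultimately show ?thesis
      using niemytzki_nbhd_subset[of p n] p by blast
  next
    case (axis y)
    have "(x, 0) \<notin> ball (y, (1/2::real) ^ 0) ((1/2) ^ 0)" for x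
      using tangent_disc_above_axis[of "(x, 0)"] by fastforce
    then have "niemytzki_nbhd p 0 \<subseteq> niemytzki_plane - {(x, 0) | x. x \<in> A}"
      using p niemytzki_nbhd_subset[of p 0] unfolding axis niemytzki_nbhd_axis by blast
    then show ?thesis ..
  qed
qed blast

text \<open>The part of the axis outside \<^term>\<open>A\<close> is left out, so that the collars of sets that are
  glued to each other are glued in the same way.\<close>

definition niemytzki_collar :: "(real \<times> real) set \<Rightarrow> nat \<Rightarrow> (real \<times> real) set" where
  "niemytzki_collar A k =
     {q \<in> niemytzki_plane. \<exists>p\<in>A. q \<in> niemytzki_nbhd p k \<and> (snd q = 0 \<longrightarrow> q = p)}"

lemma mem_niemytzki_nbhd_self:
  "p \<in> niemytzki_plane \<Longrightarrow> p \<in> niemytzki_nbhd p k"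
  by (auto simp: niemytzki_nbhd_def)

lemma niemytzki_collar_axis_iff:
  "(x, 0) \<in> niemytzki_collar A k \<longleftrightarrow> (x, 0) \<in> A"
  using mem_niemytzki_nbhd_self[of "(x, 0)"]
  by (auto simp: niemytzki_collar_def niemytzki_plane_def)

lemma openin_niemytzki_collar:
  assumes A: "A \<subseteq> niemytzki_plane"
  shows "openin niemytzki_topology (niemytzki_collar A k)"
  unfolding openin_niemytzki
proof (intro conjI ballI)
  fix q assume q: "q \<in> niemytzki_collar A k"
  then obtain p where p: "p \<in> A" "q \<in> niemytzki_nbhd p k" "snd q = 0 \<longrightarrow> q = p"
      and qN: "q \<in> niemytzki_plane"
    by (auto simp: niemytzki_collar_def)
  from qN show "\<exists>n. niemytzki_nbhd q n \<subseteq> niemytzki_collar A k"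
  proof (cases rule: niemytzki_plane_cases)
    case above
    define B where "B = (if snd p > 0 then ball p ((1/2) ^ k) else ball (fst p, (1/2) ^ k) ((1/2) ^ k))"
    have "open (B \<inter> {q. snd q > 0})"
      unfolding B_def by (intro open_Int open_Collect_less continuous_intros) auto
    moreover have "q \<in> B \<inter> {q. snd q > 0}"
      using p above by (auto simp: B_def niemytzki_nbhd_def split: if_splits)
    ultimately obtain e where "e > 0" "ball q e \<subseteq> B \<inter> {q. snd q > 0}"
      using openE by blast
    then obtain n where "niemytzki_nbhd q n \<subseteq> B \<inter> {q. snd q > 0}"
      using niemytzki_nbhd_small[OF qN] by blast
    moreover have "u \<in> niemytzki_collar A k" if u: "u \<in> B" "snd u > 0" for u
    proof -
      have uN: "u \<in> niemytzki_plane"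
        using u by (cases u) (simp add: niemytzki_plane_def)
      then have "u \<in> niemytzki_nbhd p k"
        using u by (simp add: B_def niemytzki_nbhd_def split: if_splits)
      then show ?thesis
        using uN u(2) \<open>p \<in> A\<close> by (simp add: niemytzki_collar_def) (rule bexI)
    qed
    ultimately show ?thesis
      by blast
  next
    case (axis x)
    have "q \<in> A"
      using p axis by simp
    have "u \<in> niemytzki_collar A k" if u: "u \<in> niemytzki_nbhd q k" for u
    proof -
      have "snd u \<noteq> 0 \<or> u = q"
        using u tangent_disc_above_axis[of u x] by (force simp: axis niemytzki_nbhd_axis)
      then show ?thesis
        using u \<open>q \<in> A\<close> niemytzki_nbhd_subset[OF qN] unfolding niemytzki_collar_def by blast
    qed
    then show ?thesis
      by blast
  qed
qed (auto simp: niemytzki_collar_def)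

text \<open>On the axis all collars of \<^term>\<open>A\<close> agree with \<^term>\<open>A\<close>.  Above it they shrink to the
  Euclidean closure of \<^term>\<open>A\<close>, and there the two topologies have the same closed sets.\<close>

lemma Inter_niemytzki_collar:
  assumes A: "closedin niemytzki_topology A"
  shows "(\<Inter>k. niemytzki_collar A k) = A"
proof (intro equalityI subsetI)
  have sub: "A \<subseteq> niemytzki_plane"
    using closedin_subset[OF A] by simp
  fix q
  show "q \<in> (\<Inter>k. niemytzki_collar A k)" if "q \<in> A"
    using that sub mem_niemytzki_nbhd_self[of q] unfolding niemytzki_collar_def by blast
  assume q: "q \<in> (\<Inter>k. niemytzki_collar A k)"
  then have qN: "q \<in> niemytzki_plane"
    by (auto simp: niemytzki_collar_def)
  then show "q \<in> A"
  proof (cases rule: niemytzki_plane_cases)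
    case above
    show ?thesis
    proof (rule ccontr)
      assume "q \<notin> A"
      moreover have "openin niemytzki_topology (niemytzki_plane - A)"
        using A by (simp add: closedin_def)
      ultimately obtain n where n: "niemytzki_nbhd q n \<subseteq> niemytzki_plane - A"
        using qN unfolding openin_niemytzki by blast
      obtain p where p: "p \<in> A" "q \<in> niemytzki_nbhd p (Suc n)"
        using q unfolding niemytzki_collar_def by blast
      have "dist q p < (1/2) ^ n"
        using niemytzki_nbhd_subset_ball[of p "Suc n"] p sub by (force simp: dist_commute)
      then have "p \<in> niemytzki_nbhd q n"
        using above p sub by (auto simp: niemytzki_nbhd_def)
      then show False
        using n p by blast
    qed
  next
    case (axis x)
    then show ?thesis
      using q by (auto simp: niemytzki_collar_axis_iff)
  qed
qed


section \<open>Continuous functions on the axis\<close>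

text \<open>On the axis a continuous function is the pointwise limit of its restrictions to the
  horizontal lines at height \<open>(1/2) ^ i\<close>, which are continuous on the real line.  By the Baire
  category theorem the convergence is, up to \<^term>\<open>e\<close>, uniform on some subinterval.\<close>

lemma niemytzki_axis_small_oscillation:
  assumes f: "continuous_map niemytzki_topology euclideanreal f"
    and J: "open J" "J \<noteq> {}" and e: "e > 0"
  shows "\<exists>I. open I \<and> I \<noteq> {} \<and> I \<subseteq> J \<and> (\<forall>x\<in>I. \<forall>y\<in>I. \<bar>f (x, 0) - f (y, 0)\<bar> \<le> e)"
proof -
  define g where "g = (\<lambda>i x. f (x, (1/2::real) ^ i))"
  have g: "continuous_on UNIV (g i)" for i
  proof -
    have "isCont (\<lambda>x. f (x, (1/2::real) ^ i)) x" for x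
      by (rule isCont_o2[where g = f])
        (simp_all add: continuous_map_niemytzki_imp_isCont[OF f] continuous_Pair)
    then show ?thesis
      by (simp add: g_def continuous_on_eq_continuous_at)
  qed
  have lim: "\<exists>n. \<forall>i\<ge>n. \<bar>f (x, 0) - g i x\<bar> \<le> e / 8" for x
  proof -
    have "(x, 0) \<in> niemytzki_plane"
      by (simp add: niemytzki_plane_def)
    then obtain n where n: "\<forall>q\<in>niemytzki_nbhd (x, 0) n. dist (f (x, 0)) (f q) < e / 8"
      using f e unfolding continuous_map_niemytzki by (meson divide_pos_pos zero_less_numeral)
    have "(x, (1/2) ^ i) \<in> niemytzki_nbhd (x, 0) n" if "i \<ge> n" for i
    proof -
      have "(1/2::real) ^ i \<le> (1/2) ^ n" "(1/2::real) ^ i > 0"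
        using that by (simp_all add: power_decreasing)
      then show ?thesis
        by (simp add: niemytzki_nbhd_axis dist_Pair_Pair dist_real_def)
    qed
    then have "\<forall>i\<ge>n. dist (f (x, 0)) (g i x) < e / 8"
      using n by (simp add: g_def)
    then show ?thesis
      unfolding dist_real_def by (meson less_imp_le)
  qed
  \<comment> \<open>The closed ball keeps the sets of the covering inside \<^term>\<open>J\<close>.\<close>
  obtain a d where d: "d > 0" "cball a d \<subseteq> J"
    using J open_contains_cball by (metis all_not_in_conv)
  define F where "F = (\<lambda>n. {x. \<forall>i\<ge>n. \<bar>g n x - g i x\<bar> \<le> e / 4} \<inter> cball a d)"
  have F_closed: "closed (F n)" for n
  proof -
    have "{x. \<forall>i\<ge>n. \<bar>g n x - g i x\<bar> \<le> e / 4} = (\<Inter>i\<in>{n..}. {x. \<bar>g n x - g i x\<bar> \<le> e / 4})"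
      by auto
    moreover have "closed {x. \<bar>g n x - g i x\<bar> \<le> e / 4}" for i
      using g by (intro closed_Collect_le continuous_intros) auto
    ultimately show ?thesis
      by (simp add: F_def closed_INT closed_Int)
  qed
  have F_cover: "x \<in> (\<Union>n. F n)" if x: "x \<in> cball a d" for x
  proof -
    obtain n where n: "\<forall>i\<ge>n. \<bar>f (x, 0) - g i x\<bar> \<le> e / 8"
      using lim by blast
    have "\<bar>g n x - g i x\<bar> \<le> e / 4" if "i \<ge> n" for i
    proof -
      have "\<bar>f (x, 0) - g i x\<bar> \<le> e / 8" "\<bar>f (x, 0) - g n x\<bar> \<le> e / 8"
        using n that by blast+
      then show ?thesis
        by linarith
    qed
    then show ?thesis
      using x by (auto simp: F_def)
  qed
  have "\<exists>n. interior (F n) \<noteq> {}"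
  proof (rule ccontr)
    assume "\<nexists>n. interior (F n) \<noteq> {}"
    then have "UNIV \<subseteq> closure (- F n)" for n
      by (simp add: closure_complement)
    moreover have "open (- F n)" for n
      using F_closed by (simp add: open_Compl)
    ultimately have "UNIV \<subseteq> closure (\<Inter>n. - F n)"
      by (intro Baire) auto
    moreover have "(\<Inter>n. - F n) \<subseteq> - cball a d"
      using F_cover by blast
    ultimately have "a \<in> closure (- cball a d)"
      using closure_mono by blast
    moreover have "a \<in> interior (cball a d)"
      using d by (simp add: interior_cball)
    ultimately show False
      by (simp add: closure_complement)
  qed
  then obtain n b where b: "b \<in> interior (F n)"
    by blast
  \<comment> \<open>On \<open>I\<close> the function is within \<open>e / 8 + e / 4 + e / 8 = e / 2\<close> of \<^term>\<open>g n b\<close>: the three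
    terms come from the limit, from \<^term>\<open>F n\<close> and from the continuity of \<^term>\<open>g n\<close>.\<close>
  define I where "I = interior (F n) \<inter> g n -` ball (g n b) (e / 8)"
  have "open I"
    unfolding I_def using g[of n] by (intro open_Int open_vimage) auto
  moreover have "b \<in> I"
    using b e by (simp add: I_def)
  moreover have "I \<subseteq> J"
    using d interior_subset[of "F n"] by (auto simp: I_def F_def)
  moreover have "\<bar>f (x, 0) - g n b\<bar> \<le> e / 2" if x: "x \<in> I" for x
  proof -
    obtain k where k: "\<forall>i\<ge>k. \<bar>f (x, 0) - g i x\<bar> \<le> e / 8"
      using lim by blast
    have "x \<in> F n"
      using x interior_subset[of "F n"] by (auto simp: I_def)
    then have "\<bar>g n x - g (max k n) x\<bar> \<le> e / 4"
      by (simp add: F_def)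
    moreover have "\<bar>f (x, 0) - g (max k n) x\<bar> \<le> e / 8"
      using k by simp
    moreover have "\<bar>g n b - g n x\<bar> < e / 8"
      using x by (simp add: I_def dist_real_def)
    ultimately show ?thesis
      by linarith
  qed
  ultimately have "\<bar>f (x, 0) - f (y, 0)\<bar> \<le> e" if "x \<in> I" "y \<in> I" for x y
    using that by (smt (verit) field_sum_of_halves)
  then show ?thesis
    using \<open>open I\<close> \<open>b \<in> I\<close> \<open>I \<subseteq> J\<close> by blast
qed


section \<open>The quotient map\<close>

definition library_point :: "shelf_point \<Rightarrow> shelf_point set" where
  "library_point a = glue_rel `` {a}"

lemma quotient_map_library_point: "quotient_map pre_library library_space library_point"
  using quotient_map_library_space by (simp add: library_point_def[abs_def])

lemma topspace_library_image: "topspace library_space = library_point ` topspace pre_library"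
  using quotient_imp_surjective_map[OF quotient_map_library_point] by simp

lemma None_in_topspace: "None \<in> topspace pre_library"
  by (simp add: topspace_pre_library)

lemma Some_in_topspace_iff: "Some (p, m, n) \<in> topspace pre_library \<longleftrightarrow> p \<in> niemytzki_plane"
  by (auto simp: topspace_pre_library)

lemma axis_in_plane: "(x, 0) \<in> niemytzki_plane"
  by (simp add: niemytzki_plane_def)

text \<open>Functions are tested on the generating identifications only.  A set is invariant if its
  membership predicate is.  The parity condition says that \<^term>\<open>x\<close> lies on the seam between
  the shelves \<^term>\<open>n\<close> and \<^term>\<open>Suc n\<close>.\<close>

definition glue_invariant :: "(shelf_point \<Rightarrow> 'a) \<Rightarrow> bool" where
  "glue_invariant f \<longleftrightarrow>
     (\<forall>x m n. (even n \<longleftrightarrow> x \<in> \<rat>) \<longrightarrow> f (Some ((x, 0), m, n)) = f (Some ((x, 0), m, Suc n)))"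

lemma library_point_eq_iff: "library_point a = library_point b \<longleftrightarrow> equivclp glue a b"
  using eq_equiv_class_iff[OF equiv_glue_rel, of a b] by (simp add: library_point_def glue_rel_def)

lemma glue_invariant_library_point: "glue_invariant library_point"
  unfolding glue_invariant_def
proof (intro allI impI)
  fix x :: real and m n :: nat
  assume "even n \<longleftrightarrow> x \<in> \<rat>"
  then have "glue (Some ((x, 0), m, n)) (Some ((x, 0), m, Suc n))"
    by (auto simp: glue_def)
  then show "library_point (Some ((x, 0), m, n)) = library_point (Some ((x, 0), m, Suc n))"
    unfolding library_point_eq_iff by (rule r_into_equivclp)
qed

lemma glue_invariant_eq:
  assumes "glue_invariant f" "library_point a = library_point b"
  shows "f a = f b"
proof -
  have "equivclp glue a b"
    using assms(2) by (simp add: library_point_eq_iff)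
  then show ?thesis
  proof (induction rule: equivclp_induct)
    case (step y z)
    have "f y = f z" if "glue y z" for y z
      using that assms(1) by (fastforce simp: glue_def glue_invariant_def)
    then show ?case
      using step by metis
  qed simp
qed

lemma library_point_mem_image_iff:
  assumes "glue_invariant (\<lambda>a. a \<in> W)"
  shows "library_point a \<in> library_point ` W \<longleftrightarrow> a \<in> W"
  using glue_invariant_eq[OF assms] by blast

lemma openin_shelves_iff:
  "openin shelves_topology S \<longleftrightarrow> (\<forall>m n. openin niemytzki_topology {p. (p, m, n) \<in> S})"
proof
  assume S: "openin shelves_topology S"
  show "\<forall>m n. openin niemytzki_topology {p. (p, m, n) \<in> S}"
  proof (intro allI)
    fix m n
    have "continuous_map niemytzki_topology shelves_topology (\<lambda>p. (p, m, n))"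
      unfolding shelves_topology_def by (intro continuous_map_pairedI) auto
    then have "openin niemytzki_topology {p \<in> topspace niemytzki_topology. (p, m, n) \<in> S}"
      using S by (rule openin_continuous_map_preimage)
    moreover have "{p \<in> topspace niemytzki_topology. (p, m, n) \<in> S} = {p. (p, m, n) \<in> S}"
      using openin_subset[OF S] by auto
    ultimately show "openin niemytzki_topology {p. (p, m, n) \<in> S}"
      by simp
  qed
next
  assume R: "\<forall>m n. openin niemytzki_topology {p. (p, m, n) \<in> S}"
  have "{(m, n)} = {m} \<times> {n}" for m n :: nat
    by simp
  then have "openin (prod_topology (discrete_topology UNIV) (discrete_topology UNIV)) {(m, n)}"
    for m n :: nat
    by (metis openin_prod_Times_iff openin_discrete_topology subset_UNIV)
  then have "openin shelves_topology (\<Union>i. {p. (p, fst i, snd i) \<in> S} \<times> ({fst i} \<times> {snd i}))"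
    using R by (intro openin_Union) (auto simp: shelves_topology_def openin_prod_Times_iff)
  moreover have "(\<Union>i. {p. (p, fst i, snd i) \<in> S} \<times> ({fst i} \<times> {snd i})) = S"
    by auto
  ultimately show "openin shelves_topology S"
    by simp
qed

lemma openin_pre_library_iff:
  "openin pre_library W \<longleftrightarrow>
     (\<forall>m n. openin niemytzki_topology {p. Some (p, m, n) \<in> W}) \<and>
     (None \<in> W \<longrightarrow> (\<exists>k. \<forall>p\<in>niemytzki_plane. \<forall>m\<ge>k. \<forall>n\<ge>k. Some (p, m, n) \<in> W))"
proof -
  have "infinity_nbhd k \<subseteq> W \<longleftrightarrow>
      None \<in> W \<and> (\<forall>p\<in>niemytzki_plane. \<forall>m\<ge>k. \<forall>n\<ge>k. Some (p, m, n) \<in> W)" for k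
    by (auto simp: infinity_nbhd_def)
  then show ?thesis
    by (auto simp: openin_pre_library openin_shelves_iff)
qed

lemma openin_library_space_image:
  assumes W: "openin pre_library W" and inv: "glue_invariant (\<lambda>a. a \<in> W)"
  shows "openin library_space (library_point ` W)"
proof -
  have eq: "{a \<in> topspace pre_library. library_point a \<in> library_point ` W} = W"
    using openin_subset[OF W] by (auto simp: library_point_mem_image_iff[OF inv])
  have "library_point ` W \<subseteq> topspace library_space"
    using openin_subset[OF W] by (auto simp: topspace_library_image)
  then have "openin pre_library {a \<in> topspace pre_library. library_point a \<in> library_point ` W}
      \<longleftrightarrow> openin library_space (library_point ` W)"
    using quotient_map_library_point unfolding quotient_map_def by blast
  then show ?thesis
    using W by (simp only: eq)
qed

lemma openin_library_space_preimage:
  assumes "openin library_space U"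
  shows "openin pre_library {a \<in> topspace pre_library. library_point a \<in> U}"
  using assms quotient_imp_continuous_map[OF quotient_map_library_point]
  by (rule openin_continuous_map_preimage[rotated])

lemma continuous_map_shelf: "continuous_map niemytzki_topology pre_library (\<lambda>p. Some (p, m, n))"
  unfolding continuous_map
proof (intro conjI allI impI)
  show "(\<lambda>p. Some (p, m, n)) ` topspace niemytzki_topology \<subseteq> topspace pre_library"
    by (auto simp: Some_in_topspace_iff)
  fix W assume W: "openin pre_library W"
  then have "{p \<in> topspace niemytzki_topology. Some (p, m, n) \<in> W} = {p. Some (p, m, n) \<in> W}"
    using openin_subset[OF W] by (auto simp: topspace_pre_library)
  then show "openin niemytzki_topology {p \<in> topspace niemytzki_topology. Some (p, m, n) \<in> W}"
    using W by (simp add: openin_pre_library_iff)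
qed

lemma continuous_map_library_shelf:
  "continuous_map niemytzki_topology library_space (\<lambda>p. library_point (Some (p, m, n)))"
  using continuous_map_compose[OF continuous_map_shelf
      quotient_imp_continuous_map[OF quotient_map_library_point]]
  by (simp add: o_def)

lemma library_function_exists:
  fixes f :: "shelf_point \<Rightarrow> real"
  assumes shelf: "\<And>m n. continuous_map niemytzki_topology euclideanreal (\<lambda>p. f (Some (p, m, n)))"
    and infinity: "\<And>e. e > 0 \<Longrightarrow>
       \<exists>k. \<forall>p\<in>niemytzki_plane. \<forall>m\<ge>k. \<forall>n\<ge>k. dist (f None) (f (Some (p, m, n))) < e"
    and glued: "glue_invariant f"
  shows "\<exists>g. continuous_map library_space euclideanreal g \<and>
             (\<forall>a\<in>topspace pre_library. g (library_point a) = f a)"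
proof -
  have "openin pre_library {a \<in> topspace pre_library. f a \<in> U}" if U: "open U" for U
    unfolding openin_pre_library_iff
  proof (intro conjI allI impI)
    fix m n
    have "openin niemytzki_topology {p \<in> topspace niemytzki_topology. f (Some (p, m, n)) \<in> U}"
      using U by (intro openin_continuous_map_preimage[OF shelf]) simp
    then show "openin niemytzki_topology {p. Some (p, m, n) \<in> {a \<in> topspace pre_library. f a \<in> U}}"
      by (simp add: Some_in_topspace_iff)
  next
    assume "None \<in> {a \<in> topspace pre_library. f a \<in> U}"
    then obtain e where e: "e > 0" "ball (f None) e \<subseteq> U"
      using U openE by blast
    then obtain k where
      "\<forall>p\<in>niemytzki_plane. \<forall>m\<ge>k. \<forall>n\<ge>k. dist (f None) (f (Some (p, m, n))) < e"
      using infinity by blast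
    then show "\<exists>k. \<forall>p\<in>niemytzki_plane. \<forall>m\<ge>k. \<forall>n\<ge>k.
        Some (p, m, n) \<in> {a \<in> topspace pre_library. f a \<in> U}"
      using e by (intro exI[of _ k]) (auto simp: Some_in_topspace_iff)
  qed
  then have "continuous_map pre_library euclideanreal f"
    by (simp add: continuous_map_def)
  then show ?thesis
    using quotient_map_lift_exists[OF quotient_map_library_point, of euclideanreal f]
      glue_invariant_eq[OF glued] by (metis (no_types, lifting))
qed


section \<open>Points on the shelves\<close>

lemma library_point_same_row:
  assumes "library_point (Some (p, m, n)) = library_point (Some (q, m', n'))"
  shows "m = m'"
proof -
  have "glue_invariant (map_option (\<lambda>(p, m, n). m))"
    by (simp add: glue_invariant_def)
  from glue_invariant_eq[OF this assms] show ?thesis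
    by simp
qed

text \<open>The two seams on the axis of one shelf have no common point, so a point of that axis is glued
  to at most one other shelf.  The higher one of the two shelves that are glued at a point is an
  invariant of the gluing.\<close>

lemma library_point_shelf_bound:
  assumes "library_point (Some (p, m, n)) = library_point (Some (q, m', n'))"
  shows "n \<le> Suc n'"
proof -
  define seam where "seam = (\<lambda>a :: shelf_point. case a of None \<Rightarrow> 0
      | Some (p, m, n) \<Rightarrow> if snd p = 0 \<and> (even n \<longleftrightarrow> fst p \<in> \<rat>) then Suc n else n)"
  have "glue_invariant seam"
    by (auto simp: glue_invariant_def seam_def)
  from glue_invariant_eq[OF this assms] show ?thesis
    by (simp add: seam_def split: if_splits)
qed

text \<open>A separating function of the plane is put on each shelf that contains the point, and 1
  everywhere else.  It is 1 on all other points of the axis, so the gluing is respected, and it is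
  1 on all other rows, so it is continuous at infinity.  Its neighbourhood of \<^term>\<open>p\<close> has to fit
  into \<^term>\<open>U\<close> on all these shelves at once, which is possible as there are finitely many.\<close>

lemma library_separating_function_shelf:
  assumes p: "p \<in> niemytzki_plane"
    and U: "openin library_space U" "library_point (Some (p, m, n)) \<in> U"
  shows "\<exists>g. continuous_map library_space euclideanreal g \<and>
           {z \<in> topspace library_space. g z = 0} = {library_point (Some (p, m, n))} \<and>
           (\<forall>z\<in>topspace library_space - U. g z = 1)"
proof -
  let ?z = "library_point (Some (p, m, n))"
  define I where "I = {n'. n' \<le> Suc n \<and> library_point (Some (p, m, n')) = ?z}"
  have I: "finite I" "I \<noteq> {}"
    by (auto simp: I_def intro: exI[of _ n])
  define V where
    "V = (\<Inter>n'\<in>I. {q \<in> topspace niemytzki_topology. library_point (Some (q, m, n')) \<in> U})"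
  have "openin niemytzki_topology V"
    unfolding V_def using I U(1)
    by (intro openin_Inter)
      (auto intro: openin_continuous_map_preimage[OF continuous_map_library_shelf, simplified])
  moreover have "p \<in> V"
    using U p by (auto simp: V_def I_def)
  ultimately obtain h where h: "continuous_map niemytzki_topology euclideanreal h"
      "\<And>q. q \<in> niemytzki_plane \<Longrightarrow> h q = 0 \<longleftrightarrow> q = p"
      "\<And>q. q \<in> niemytzki_plane - V \<Longrightarrow> h q = 1"
      "\<And>x. (x, 0) \<noteq> p \<Longrightarrow> h (x, 0) = 1"
    using niemytzki_separating_function by metis
  define f where "f = (\<lambda>a. case a of None \<Rightarrow> 1
      | Some (q, m', n') \<Rightarrow> if library_point (Some (p, m', n')) = ?z then h q else 1)"
  have "\<exists>g. continuous_map library_space euclideanreal g \<and>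
             (\<forall>a\<in>topspace pre_library. g (library_point a) = f a)"
  proof (rule library_function_exists)
    fix m' n'
    show "continuous_map niemytzki_topology euclideanreal (\<lambda>q. f (Some (q, m', n')))"
      using h(1) by (simp add: f_def)
  next
    fix e :: real assume "e > 0"
    then have "dist (f None) (f (Some (q, m', n'))) < e" if "m' \<ge> Suc m" for q m' n'
      using that library_point_same_row[of p m' n' p m n] by (auto simp: f_def)
    then show "\<exists>k. \<forall>q\<in>niemytzki_plane. \<forall>m'\<ge>k. \<forall>n'\<ge>k. dist (f None) (f (Some (q, m', n'))) < e"
      by (intro exI[of _ "Suc m"]) simp
  next
    have "f (Some ((x, 0), m', n')) = f (Some ((x, 0), m', Suc n'))"
      if "even n' \<longleftrightarrow> x \<in> \<rat>" for x m' n'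
    proof (cases "(x, 0) = p")
      case True
      then have "library_point (Some (p, m', n')) = library_point (Some (p, m', Suc n'))"
        using glue_invariant_library_point that by (auto simp: glue_invariant_def)
      then show ?thesis
        by (simp add: f_def)
    qed (simp add: f_def h(4))
    then show "glue_invariant f"
      by (simp add: glue_invariant_def)
  qed
  then obtain g where g: "continuous_map library_space euclideanreal g"
      "\<And>a. a \<in> topspace pre_library \<Longrightarrow> g (library_point a) = f a"
    by blast
  have "g ?z = 0"
    using g(2) h(2) p by (simp add: Some_in_topspace_iff f_def)
  moreover have "z = ?z" if z: "z \<in> topspace library_space" "g z = 0" for z
  proof -
    obtain a where a: "a \<in> topspace pre_library" "z = library_point a"
      using z by (auto simp: topspace_library_image)
    then have "f a = 0"
      using z g(2) by simp
    then obtain q m' n' where "a = Some (q, m', n')" "library_point (Some (p, m', n')) = ?z" "h q = 0"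
      by (auto simp: f_def split: option.splits if_splits)
    then show ?thesis
      using a h(2) by (auto simp: Some_in_topspace_iff)
  qed
  moreover have "?z \<in> topspace library_space"
    using p by (auto simp: topspace_library_image Some_in_topspace_iff)
  moreover have "g z = 1" if z: "z \<in> topspace library_space - U" for z
  proof -
    obtain a where a: "a \<in> topspace pre_library" "z = library_point a"
      using z by (auto simp: topspace_library_image)
    have "f a = 1"
    proof (rule ccontr)
      assume "f a \<noteq> 1"
      then obtain q m' n' where q: "a = Some (q, m', n')" "library_point (Some (p, m', n')) = ?z"
          "h q \<noteq> 1"
        by (auto simp: f_def split: option.splits if_splits)
      then have "q \<in> V" "m' = m" "n' \<le> Suc n"
        using h(3)[of q] a library_point_same_row library_point_shelf_bound
        by (auto simp: Some_in_topspace_iff)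
      then show False
        using q z a by (auto simp: V_def I_def)
    qed
    then show ?thesis
      using a g(2) by simp
  qed
  ultimately show ?thesis
    using g(1) by blast
qed


section \<open>The point at infinity\<close>

lemma library_point_eq_None_iff: "library_point a = library_point None \<longleftrightarrow> a = None"
proof -
  have "glue_invariant (\<lambda>a. a = None)"
    by (simp add: glue_invariant_def)
  from glue_invariant_eq[OF this] show ?thesis
    by blast
qed

lemma library_space_cases:
  assumes "z \<in> topspace library_space"
  obtains (infinity) "z = library_point None"
    | (shelf) p m n where "z = library_point (Some (p, m, n))" "p \<in> niemytzki_plane"
proof -
  obtain a where a: "a \<in> topspace pre_library" "z = library_point a"
    using assms by (auto simp: topspace_library_image)
  show thesis
  proof (cases a)
    case None
    then show thesis
      using a infinity by simp
  next
    case (Some b)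
    then show thesis
      using a shelf by (cases b) (auto simp: Some_in_topspace_iff)
  qed
qed

text \<open>A function of the row number alone respects every identification, as these are made within
  a row; and the row number tends to infinity along the neighbourhoods of infinity.\<close>

lemma zero_set_in_library_infinity: "zero_set_in library_space {library_point None}"
proof -
  define f where "f = (\<lambda>a :: shelf_point. case a of None \<Rightarrow> 0 | Some (p, m, n) \<Rightarrow> 1 / real (Suc m))"
  have "\<exists>g. continuous_map library_space euclideanreal g \<and>
             (\<forall>a\<in>topspace pre_library. g (library_point a) = f a)"
  proof (rule library_function_exists)
    fix e :: real assume "e > 0"
    then obtain k where k: "1 / real (Suc k) < e"
      using nat_approx_posE by blast
    have "dist (f None) (f (Some (p, m, n))) < e" if "m \<ge> k" for p m n
    proof -
      have "1 / real (Suc m) \<le> 1 / real (Suc k)"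
        using that by (intro divide_left_mono) auto
      then show ?thesis
        using k by (simp add: f_def dist_real_def)
    qed
    then show "\<exists>k. \<forall>p\<in>niemytzki_plane. \<forall>m\<ge>k. \<forall>n\<ge>k. dist (f None) (f (Some (p, m, n))) < e"
      by blast
  qed (simp_all add: f_def glue_invariant_def)
  then obtain g where g: "continuous_map library_space euclideanreal g"
      "\<And>a. a \<in> topspace pre_library \<Longrightarrow> g (library_point a) = f a"
    by blast
  have "f a = 0 \<longleftrightarrow> a = None" for a
    by (auto simp: f_def split: option.splits)
  then have "{z \<in> topspace library_space. g z = 0} = {library_point None}"
    using g(2) None_in_topspace by (auto simp: topspace_library_image)
  then show ?thesis
    using g(1) unfolding zero_set_in_def by blast
qed

text \<open>The shelves \<open>n \<ge> k\<close> of the rows \<open>m \<ge> k\<close> need not form an open or a closed set, since shelf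
  \<open>k\<close> is also glued to shelf \<open>k - 1\<close>.  The seam between \<open>k\<close> and \<open>k + 1\<close>, called \<^term>\<open>D\<close> in the
  proof, gives both: without this seam the shelves from \<open>k + 1\<close> on are open, because on shelf
  \<open>k + 1\<close> only the seam to \<open>k + 2\<close> is left; with it they are closed, because on shelf \<open>k\<close> they leave
  an open set, any part of the axis being closed.\<close>

lemma library_closed_nbhd_infinity:
  assumes U: "openin library_space U" "library_point None \<in> U"
  shows "\<exists>V K. openin library_space V \<and> closedin library_space K \<and>
               library_point None \<in> V \<and> V \<subseteq> K \<and> K \<subseteq> U"
proof -
  obtain k where k: "\<And>p m n. p \<in> niemytzki_plane \<Longrightarrow> m \<ge> k \<Longrightarrow> n \<ge> k \<Longrightarrow>
      library_point (Some (p, m, n)) \<in> U"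
    using openin_library_space_preimage[OF U(1)] U(2) None_in_topspace
    unfolding openin_pre_library_iff by blast
  define D where "D = {(x, 0 :: real) | x :: real. x \<in> {x. even k \<longleftrightarrow> x \<in> \<rat>}}"
  have D_iff: "(x, 0) \<in> D \<longleftrightarrow> (even k \<longleftrightarrow> x \<in> \<rat>)" for x
    by (auto simp: D_def)
  have D_compl: "openin niemytzki_topology (niemytzki_plane - D)"
    unfolding D_def by (rule openin_niemytzki_remove_axis_points)
  have plane: "openin niemytzki_topology niemytzki_plane"
    using openin_topspace[of niemytzki_topology] by simp
  define V where "V = insert None {Some (p, m, n) | p m n.
      p \<in> niemytzki_plane \<and> m \<ge> k \<and> (n \<ge> k + 2 \<or> n = k + 1 \<and> p \<notin> D)}"
  define L where "L = {Some (p, m, n) | p m n.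
      p \<in> niemytzki_plane \<and> (m < k \<or> n < k \<or> n = k \<and> p \<notin> D)}"
  have V: "openin pre_library V"
    unfolding openin_pre_library_iff
  proof (intro conjI allI impI)
    fix m n
    have "{p. Some (p, m, n) \<in> V} = (if m \<ge> k \<and> n \<ge> k + 2 then niemytzki_plane
        else if m \<ge> k \<and> n = k + 1 then niemytzki_plane - D else {})"
      by (auto simp: V_def)
    then show "openin niemytzki_topology {p. Some (p, m, n) \<in> V}"
      using D_compl plane by simp
  next
    show "\<exists>k. \<forall>p\<in>niemytzki_plane. \<forall>m\<ge>k. \<forall>n\<ge>k. Some (p, m, n) \<in> V"
      by (intro exI[of _ "k + 2"]) (auto simp: V_def)
  qed
  have V_inv: "glue_invariant (\<lambda>a. a \<in> V)"
    unfolding glue_invariant_def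
  proof (intro allI impI)
    fix x :: real and m n :: nat assume "even n \<longleftrightarrow> x \<in> \<rat>"
    then show "(Some ((x, 0), m, n) \<in> V) = (Some ((x, 0), m, Suc n) \<in> V)"
      by (cases "n = k"; cases "n = Suc k") (auto simp: V_def D_iff axis_in_plane)
  qed
  have L: "openin pre_library L"
    unfolding openin_pre_library_iff
  proof (intro conjI allI impI)
    fix m n
    have "{p. Some (p, m, n) \<in> L} = (if m < k \<or> n < k then niemytzki_plane
        else if n = k then niemytzki_plane - D else {})"
      by (auto simp: L_def)
    then show "openin niemytzki_topology {p. Some (p, m, n) \<in> L}"
      using D_compl plane by simp
  qed (simp add: L_def)
  have L_inv: "glue_invariant (\<lambda>a. a \<in> L)"
    unfolding glue_invariant_def
  proof (intro allI impI)
    fix x :: real and m n :: nat assume "even n \<longleftrightarrow> x \<in> \<rat>"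
    then show "(Some ((x, 0), m, n) \<in> L) = (Some ((x, 0), m, Suc n) \<in> L)"
      by (cases "n = k"; cases "Suc n = k") (auto simp: L_def D_iff axis_in_plane)
  qed
  let ?K = "topspace library_space - library_point ` L"
  have "openin library_space (library_point ` V)" "closedin library_space ?K"
    using openin_library_space_image[OF V V_inv] openin_library_space_image[OF L L_inv] by auto
  moreover have "library_point None \<in> library_point ` V"
    by (simp add: V_def)
  moreover have "library_point ` V \<subseteq> ?K"
  proof -
    have "V \<inter> L = {}"
      by (auto simp: V_def L_def)
    then show ?thesis
      using openin_subset[OF V] library_point_mem_image_iff[OF L_inv]
      by (auto simp: topspace_library_image)
  qed
  moreover have "?K \<subseteq> U"
  proof
    fix z assume z: "z \<in> ?K"
    then have "z \<in> topspace library_space"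
      by blast
    then show "z \<in> U"
    proof (cases rule: library_space_cases)
      case (shelf p m n)
      then have "Some (p, m, n) \<notin> L"
        using z by blast
      then have "m \<ge> k" "n \<ge> k"
        using shelf(2) by (cases p; simp add: L_def not_less)+
      then show "z \<in> U"
        using k shelf by simp
    qed (use U in simp)
  qed
  ultimately show ?thesis
    by (intro exI[of _ "library_point ` V"] exI[of _ ?K] conjI)
qed


section \<open>Regularity and zero-sets\<close>

lemma zero_set_in_library_singleton:
  assumes "z \<in> topspace library_space"
  shows "zero_set_in library_space {z}"
  using assms
proof (cases rule: library_space_cases)
  case infinity
  then show ?thesis
    using zero_set_in_library_infinity by simp
next
  case (shelf p m n)
  obtain g where "continuous_map library_space euclideanreal g"
      "{w \<in> topspace library_space. g w = 0} = {z}"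
    using library_separating_function_shelf[OF shelf(2) openin_topspace, of m n] assms shelf(1)
    by blast
  then show ?thesis
    unfolding zero_set_in_def by (intro exI[of _ g]) simp
qed

lemma zero_set_in_imp_closedin:
  assumes "zero_set_in X S"
  shows "closedin X S"
proof -
  obtain f where f: "continuous_map X euclideanreal f" "S = {z \<in> topspace X. f z \<in> {0}}"
    using assms unfolding zero_set_in_def by auto
  then show ?thesis
    using closedin_continuous_map_preimage[OF f(1), of "{0}"] by simp
qed

lemma zero_set_in_imp_gdelta_in:
  assumes "zero_set_in X S"
  shows "gdelta_in X S"
proof -
  obtain f where f: "continuous_map X euclideanreal f" "S = {z \<in> topspace X. f z = 0}"
    using assms unfolding zero_set_in_def by blast
  define G where "G = (\<lambda>k. {z \<in> topspace X. f z \<in> ball 0 (1 / real (Suc k))})"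
  have "openin X (G k)" for k
    unfolding G_def by (intro openin_continuous_map_preimage[OF f(1)]) simp
  then have "gdelta_in X (\<Inter>(range G))"
    by (intro gdelta_in_Inter) (auto intro: open_imp_gdelta_in)
  moreover have "\<Inter>(range G) = S"
  proof -
    have "f z = 0" if "z \<in> \<Inter>(range G)" for z
    proof (rule ccontr)
      assume "f z \<noteq> 0"
      then obtain k where "1 / real (Suc k) < \<bar>f z\<bar>"
        using nat_approx_posE[of "\<bar>f z\<bar>"] by auto
      moreover have "\<bar>f z\<bar> < 1 / real (Suc k)"
        using that by (auto simp: G_def dist_real_def)
      ultimately show False
        by simp
    qed
    then show ?thesis
      by (auto simp: G_def f(2))
  qed
  ultimately show ?thesis
    by simp
qed

lemma t1_space_library: "t1_space library_space"
  unfolding t1_space_closedin_singleton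
  using zero_set_in_library_singleton zero_set_in_imp_closedin by blast

text \<open>At the points on the shelves a separating function even gives complete regularity.\<close>

lemma regular_space_library: "regular_space library_space"
  unfolding neighbourhood_base_of_closedin[symmetric] neighbourhood_base_of
proof (intro allI impI)
  fix U z assume U: "openin library_space U \<and> z \<in> U"
  then have "z \<in> topspace library_space"
    using openin_subset[of library_space U] by blast
  then show "\<exists>V K. openin library_space V \<and> closedin library_space K \<and> z \<in> V \<and> V \<subseteq> K \<and> K \<subseteq> U"
  proof (cases rule: library_space_cases)
    case infinity
    then show ?thesis
      using U library_closed_nbhd_infinity[of U] by blast
  next
    case (shelf p m n)
    then have UO: "openin library_space U" and zU: "library_point (Some (p, m, n)) \<in> U"
      using U by simp_all
    from library_separating_function_shelf[OF shelf(2) UO zU, folded shelf(1)]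
    obtain g where g: "continuous_map library_space euclideanreal g"
        "{w \<in> topspace library_space. g w = 0} = {z}"
        "\<forall>w\<in>topspace library_space - U. g w = 1"
      by (elim exE conjE)
    let ?V = "{w \<in> topspace library_space. g w \<in> {..<1/2}}"
    let ?K = "{w \<in> topspace library_space. g w \<in> {..1/2}}"
    have "openin library_space ?V"
      by (intro openin_continuous_map_preimage[OF g(1)]) simp
    moreover have "closedin library_space ?K"
      by (intro closedin_continuous_map_preimage[OF g(1)]) simp
    moreover have "z \<in> ?V"
      using g(2) by auto
    moreover have "?V \<subseteq> ?K"
      by auto
    moreover have "?K \<subseteq> U"
    proof
      fix w assume w: "w \<in> ?K"
      show "w \<in> U"
      proof (rule ccontr)
        assume "w \<notin> U"
        then have "g w = 1"
          using w g(3) by simp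
        then show False
          using w by simp
      qed
    qed
    ultimately show ?thesis
      by (intro exI[of _ ?V] exI[of _ ?K] conjI)
  qed
qed


section \<open>Closed sets\<close>

text \<open>On each shelf the closed set is the intersection of its collars.  A collar adds no point of
  the axis, so the collars of the same order on all shelves fit together to an open set of the
  library.  They never contain infinity, which is added as a separate zero-set if needed.\<close>

lemma closedin_library_imp_gdelta_in:
  assumes C: "closedin library_space C"
  shows "gdelta_in library_space C"
proof -
  define A where "A = (\<lambda>m n. {p \<in> topspace niemytzki_topology. library_point (Some (p, m, n)) \<in> C})"
  have A: "closedin niemytzki_topology (A m n)" for m n
    unfolding A_def by (rule closedin_continuous_map_preimage[OF continuous_map_library_shelf C])
  have A_sub: "A m n \<subseteq> niemytzki_plane" for m n
    by (auto simp: A_def)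
  define W where "W = (\<lambda>k. {Some (p, m, n) | p m n. p \<in> niemytzki_collar (A m n) k})"
  have W_mem: "Some (p, m, n) \<in> W k \<longleftrightarrow> p \<in> niemytzki_collar (A m n) k" for p m n k
    by (cases p) (simp add: W_def)
  have W_None: "None \<notin> W k" for k
    by (simp add: W_def)
  have W_open: "openin pre_library (W k)" for k
    using openin_niemytzki_collar[OF A_sub] by (simp add: openin_pre_library_iff W_mem W_None)
  have W_inv: "glue_invariant (\<lambda>a. a \<in> W k)" for k
    using glue_invariant_library_point
    by (simp add: glue_invariant_def W_mem niemytzki_collar_axis_iff A_def)
  have "openin library_space (library_point ` W k)" for k
    using openin_library_space_image[OF W_open W_inv] .
  then have G: "gdelta_in library_space (\<Inter>k. library_point ` W k)"
    by (intro gdelta_in_Inter) (auto intro: open_imp_gdelta_in)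
  have None_not: "library_point None \<notin> (\<Inter>k. library_point ` W k)"
    using library_point_mem_image_iff[OF W_inv] W_None by blast
  have shelf_iff: "library_point (Some (p, m, n)) \<in> (\<Inter>k. library_point ` W k) \<longleftrightarrow>
      library_point (Some (p, m, n)) \<in> C" if p: "p \<in> niemytzki_plane" for p m n
  proof -
    have "library_point (Some (p, m, n)) \<in> (\<Inter>k. library_point ` W k) \<longleftrightarrow>
        p \<in> (\<Inter>k. niemytzki_collar (A m n) k)"
      by (simp add: library_point_mem_image_iff[OF W_inv] W_mem)
    also have "\<dots> \<longleftrightarrow> p \<in> A m n"
      by (simp only: Inter_niemytzki_collar[OF A])
    finally show ?thesis
      using p by (simp add: A_def)
  qed
  have sub: "(\<Inter>k. library_point ` W k) \<subseteq> topspace library_space" "C \<subseteq> topspace library_space"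
    using gdelta_in_subset[OF G] closedin_subset[OF C] .
  have eq: "(\<Inter>k. library_point ` W k) = C - {library_point None}"
  proof (intro set_eqI)
    fix z
    show "z \<in> (\<Inter>k. library_point ` W k) \<longleftrightarrow> z \<in> C - {library_point None}"
    proof (cases "z \<in> topspace library_space")
      case True
      then show ?thesis
      proof (cases rule: library_space_cases)
        case infinity
        then show ?thesis
          using None_not by simp
      next
        case (shelf p m n)
        then show ?thesis
          using library_point_eq_None_iff[of "Some (p, m, n)"]
          by (simp only: shelf(1) shelf_iff[OF shelf(2)]) simp
      qed
    next
      case False
      then show ?thesis
        using subsetD[OF sub(1)] subsetD[OF sub(2)] by (meson DiffD1)
    qed
  qed
  show ?thesis
  proof (cases "library_point None \<in> C")
    case True
    then have "C = (C - {library_point None}) \<union> {library_point None}"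
      by blast
    then show ?thesis
      using gdelta_in_Un[OF G zero_set_in_imp_gdelta_in[OF zero_set_in_library_infinity]]
      by (simp add: eq)
  next
    case False
    then show ?thesis
      using G by (simp add: eq)
  qed
qed


section \<open>Failure of complete regularity\<close>

text \<open>The information that passes from shelf to shelf has to survive a seam that is only a dense
  set of points, and a continuous function on the plane may take any value at a given point of the
  axis.  So equality with \<^term>\<open>c\<close> on a large set cannot be propagated directly; closeness on
  some part of every interval can.\<close>

definition nearly_constant :: "(real \<Rightarrow> real) \<Rightarrow> real \<Rightarrow> bool" where
  "nearly_constant u c \<longleftrightarrow>
     (\<forall>J e. open J \<longrightarrow> J \<noteq> {} \<longrightarrow> e > 0 \<longrightarrow>
        (\<exists>I. open I \<and> I \<noteq> {} \<and> I \<subseteq> J \<and> (\<forall>x\<in>I. \<bar>u x - c\<bar> \<le> e)))"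

text \<open>An interval of small oscillation contains a point where the value is close to \<^term>\<open>c\<close>, hence
  the function is close to \<^term>\<open>c\<close> on all of it.\<close>

lemma nearly_constant_niemytzki_axis:
  assumes f: "continuous_map niemytzki_topology euclideanreal f"
    and dense: "\<And>J e. open J \<Longrightarrow> J \<noteq> {} \<Longrightarrow> e > 0 \<Longrightarrow> \<exists>x\<in>J. \<bar>f (x, 0) - c\<bar> \<le> e"
  shows "nearly_constant (\<lambda>x. f (x, 0)) c"
  unfolding nearly_constant_def
proof (intro allI impI)
  fix J :: "real set" and e :: real
  assume J: "open J" "J \<noteq> {}" and e: "e > 0"
  then obtain I where I: "open I" "I \<noteq> {}" "I \<subseteq> J"
      "\<And>x y. x \<in> I \<Longrightarrow> y \<in> I \<Longrightarrow> \<bar>f (x, 0) - f (y, 0)\<bar> \<le> e / 2"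
    using niemytzki_axis_small_oscillation[OF f J, of "e / 2"] by auto
  obtain x where x: "x \<in> I" "\<bar>f (x, 0) - c\<bar> \<le> e / 2"
    using dense[OF I(1,2), of "e / 2"] e by auto
  have "\<bar>f (y, 0) - c\<bar> \<le> e" if "y \<in> I" for y
    using I(4)[OF that x(1)] x(2) by linarith
  then show "\<exists>I. open I \<and> I \<noteq> {} \<and> I \<subseteq> J \<and> (\<forall>x\<in>I. \<bar>f (x, 0) - c\<bar> \<le> e)"
    using I by blast
qed

lemma seam_dense:
  fixes J :: "real set"
  assumes "open J" "J \<noteq> {}"
  shows "\<exists>x\<in>J. P \<longleftrightarrow> x \<in> \<rat>"
proof (cases P)
  case True
  then show ?thesis
    using open_Int_closure_eq_empty[OF assms(1), of \<rat>] assms(2) Rats_closure_real by auto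
next
  case False
  then show ?thesis
    using open_minus_countable[OF countable_rat assms(2,1)] by blast
qed

text \<open>Both the rational and the irrational seam meet every interval.  So if the function is close to
  \<^term>\<open>c\<close> on an interval of the axis of one shelf, then it is close to \<^term>\<open>c\<close> at some point of
  that interval on the next shelf, and by small oscillation on a subinterval.\<close>

lemma library_row_nearly_constant:
  assumes f: "continuous_map library_space euclideanreal f"
    and start: "\<And>x. x \<notin> \<rat> \<Longrightarrow> f (library_point (Some ((x, 0), m, 0))) = c"
  shows "nearly_constant (\<lambda>x. f (library_point (Some ((x, 0), m, n)))) c"
proof (induction n)
  have shelf: "continuous_map niemytzki_topology euclideanreal
      (\<lambda>p. f (library_point (Some (p, m, n))))" for n
    using continuous_map_compose[OF continuous_map_library_shelf f] by (simp add: o_def)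
  {
    case 0
    show ?case
    proof (rule nearly_constant_niemytzki_axis[OF shelf])
      fix J :: "real set" and e :: real
      assume "open J" "J \<noteq> {}" "e > 0"
      then show "\<exists>x\<in>J. \<bar>f (library_point (Some ((x, 0), m, 0))) - c\<bar> \<le> e"
        using seam_dense[of J False] start by force
    qed
  next
    case (Suc n)
    show ?case
    proof (rule nearly_constant_niemytzki_axis[OF shelf])
      fix J :: "real set" and e :: real
      assume J: "open J" "J \<noteq> {}" and e: "e > 0"
      from Suc[unfolded nearly_constant_def, rule_format, OF J e]
      obtain I where I: "open I" "I \<noteq> {}" "I \<subseteq> J"
          "\<forall>x\<in>I. \<bar>f (library_point (Some ((x, 0), m, n))) - c\<bar> \<le> e"
        by blast
      obtain x where x: "x \<in> I" "even n \<longleftrightarrow> x \<in> \<rat>"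
        using seam_dense[OF I(1,2), of "even n"] by blast
      then have "library_point (Some ((x, 0), m, n)) = library_point (Some ((x, 0), m, Suc n))"
        using glue_invariant_library_point by (simp add: glue_invariant_def)
      then show "\<exists>x\<in>J. \<bar>f (library_point (Some ((x, 0), m, Suc n))) - c\<bar> \<le> e"
        using I x by force
    qed
  }
qed

text \<open>The irrational points on the axes of the shelves 0 form a closed set: any part of the axis is
  closed in the plane, and no identification involves these points.  A function with value 1 on
  this set is close to 1 somewhere on every shelf of every row, hence somewhere in every
  neighbourhood of infinity.\<close>

lemma not_completely_regular_space_library: "\<not> completely_regular_space library_space"
proof
  assume cr: "completely_regular_space library_space"
  define D where "D = {(x, 0 :: real) | x :: real. x \<in> - \<rat>}"
  define W where "W = topspace pre_library - {Some (p, m, 0) | p m. p \<in> D}"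
  have W: "openin pre_library W"
    unfolding openin_pre_library_iff
  proof (intro conjI allI impI)
    fix m n :: nat
    have "{p. Some (p, m, n) \<in> W} = niemytzki_plane - {(x, 0) | x. x \<in> (if n = 0 then - \<rat> else {})}"
      by (auto simp: W_def D_def Some_in_topspace_iff)
    then show "openin niemytzki_topology {p. Some (p, m, n) \<in> W}"
      by (simp only: openin_niemytzki_remove_axis_points)
  next
    show "\<exists>k. \<forall>p\<in>niemytzki_plane. \<forall>m\<ge>k. \<forall>n\<ge>k. Some (p, m, n) \<in> W"
      by (intro exI[of _ 1]) (auto simp: W_def Some_in_topspace_iff)
  qed
  have W_inv: "glue_invariant (\<lambda>a. a \<in> W)"
    by (auto simp: glue_invariant_def W_def D_def Some_in_topspace_iff axis_in_plane odd_pos)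
  have "closedin library_space (topspace library_space - library_point ` W)"
    using openin_library_space_image[OF W W_inv] by blast
  moreover have "library_point None \<in>
      topspace library_space - (topspace library_space - library_point ` W)"
    using None_in_topspace by (auto simp: topspace_library_image W_def)
  ultimately have "\<exists>f :: shelf_point set \<Rightarrow> real. continuous_map library_space (top_of_set {0..1}) f \<and>
      f (library_point None) = 0 \<and> f ` (topspace library_space - library_point ` W) \<subseteq> {1}"
    using cr unfolding completely_regular_space_def by simp
  then obtain f :: "shelf_point set \<Rightarrow> real"
    where f: "continuous_map library_space (top_of_set {0..1}) f" "f (library_point None) = 0"
      "f ` (topspace library_space - library_point ` W) \<subseteq> {1}"
    by (elim exE conjE)
  have cont: "continuous_map library_space euclideanreal f"
    using f(1) by (simp add: continuous_map_in_subtopology)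
  have "openin library_space {z \<in> topspace library_space. f z \<in> {..<1/2}}"
    by (intro openin_continuous_map_preimage[OF cont]) simp
  from openin_library_space_preimage[OF this]
  have "\<exists>k. \<forall>p\<in>niemytzki_plane. \<forall>m\<ge>k. \<forall>n\<ge>k. f (library_point (Some (p, m, n))) < 1/2"
    using f(2) None_in_topspace
    by (simp add: openin_pre_library_iff topspace_library_image Some_in_topspace_iff)
  then obtain k where k: "\<And>p m n. p \<in> niemytzki_plane \<Longrightarrow> m \<ge> k \<Longrightarrow> n \<ge> k \<Longrightarrow>
      f (library_point (Some (p, m, n))) < 1/2"
    by blast
  have "f (library_point (Some ((x, 0), k, 0))) = 1" if "x \<notin> \<rat>" for x
  proof -
    have "Some ((x, 0), k, 0) \<in> topspace pre_library - W"
      using that by (auto simp: W_def D_def Some_in_topspace_iff axis_in_plane)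
    then have "library_point (Some ((x, 0), k, 0)) \<in> topspace library_space - library_point ` W"
      by (simp add: library_point_mem_image_iff[OF W_inv] topspace_library_image)
    then show ?thesis
      using f(3) by (simp add: image_subset_iff)
  qed
  then have "nearly_constant (\<lambda>x. f (library_point (Some ((x, 0), k, k)))) 1"
    by (rule library_row_nearly_constant[OF cont])
  then have "\<exists>I. open I \<and> I \<noteq> {} \<and> I \<subseteq> UNIV \<and>
      (\<forall>x\<in>I. \<bar>f (library_point (Some ((x, 0), k, k))) - 1\<bar> \<le> 1/4)"
    unfolding nearly_constant_def by (elim allE[of _ UNIV] allE[of _ "1/4"]) simp
  then obtain x where "\<bar>f (library_point (Some ((x, 0), k, k))) - 1\<bar> \<le> 1/4"
    by blast
  then show False
    using k[OF axis_in_plane, of k k x] by simp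
qed

theorem theorem3p3:
  shows "(t1_space library_space \<and> regular_space library_space) \<and>
         \<not> (t1_space library_space \<and> completely_regular_space library_space) \<and>
         (\<forall>z \<in> topspace library_space. zero_set_in library_space {z}) \<and>
         (\<forall>C. closedin library_space C \<longrightarrow> gdelta_in library_space C)"
  using t1_space_library regular_space_library not_completely_regular_space_library
    zero_set_in_library_singleton closedin_library_imp_gdelta_in
  by blast

end
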